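(* A completely regular frame $L$ is perfectly normal if and only if it is a cozero frame and perfectly regular.
   Context: An element $a$ of a frame $L$ is a cozero element if $a=h(\mathbb{R}\setminus\{0\})$ for some frame homomorphism $h:\mathfrak{O}\mathbb{R}\to L$; $\mathrm{Coz}\,L$ is the set of cozero elements of $L$. A frame $L$ is completely regular iff every element of $L$ is a join of cozero elements; it is perfectly regular if every element is a join of cozero elements and every element is a meet of cozero elements (joins and meets computed in $L$). A frame $L$ is perfectly normal if $\mathrm{Coz}\,L=L$. A frame $L$ is a cozero frame if $\mathrm{Coz}\,L$, with the order induced from $L$, is a frame (its arbitrary joins are not required to agree with those of $L$). *)

theory Defs
  imports Complex_Main "HOL-Algebra.Complete_Lattice"
begin

locale frame = Complete_Lattice.complete_lattice +
  assumes meet_sup_distrib: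
    "\<lbrakk>x \<in> carrier L; A \<subseteq> carrier L\<rbrakk> \<Longrightarrow> x \<sqinter> \<Squnion>A = \<Squnion>((\<lambda>a. x \<sqinter> a) ` A)"

definition frame_hom ::
  "('a, 'c) gorder_scheme \<Rightarrow> ('b, 'd) gorder_scheme \<Rightarrow> ('a \<Rightarrow> 'b) \<Rightarrow> bool" where
  "frame_hom K L h \<longleftrightarrow>
     h \<in> carrier K \<rightarrow> carrier L \<and>
     h \<top>\<^bsub>K\<^esub> = \<top>\<^bsub>L\<^esub> \<and>
     (\<forall>x\<in>carrier K. \<forall>y\<in>carrier K. h (x \<sqinter>\<^bsub>K\<^esub> y) = h x \<sqinter>\<^bsub>L\<^esub> h y) \<and>
     (\<forall>A\<subseteq>carrier K. h (\<Squnion>\<^bsub>K\<^esub> A) = \<Squnion>\<^bsub>L\<^esub> (h ` A))"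

definition open_sets_frame :: "'a::topological_space set gorder" where
  "open_sets_frame = \<lparr>carrier = {U. open U}, eq = (=), le = (\<subseteq>)\<rparr>"

definition Coz :: "('a, 'c) gorder_scheme \<Rightarrow> 'a set" where
  "Coz L = {h (UNIV - {0}) | h. frame_hom (open_sets_frame :: real set gorder) L h}"

definition completely_regular :: "('a, 'c) gorder_scheme \<Rightarrow> bool" where
  "completely_regular L \<longleftrightarrow> (\<forall>a\<in>carrier L. \<exists>S\<subseteq>Coz L. a = \<Squnion>\<^bsub>L\<^esub> S)"

definition perfectly_regular :: "('a, 'c) gorder_scheme \<Rightarrow> bool" where
  "perfectly_regular L \<longleftrightarrow>
     (\<forall>a\<in>carrier L. \<exists>S\<subseteq>Coz L. a = \<Squnion>\<^bsub>L\<^esub> S) \<and>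
     (\<forall>a\<in>carrier L. \<exists>S\<subseteq>Coz L. a = \<Sqinter>\<^bsub>L\<^esub> S)"

definition perfectly_normal :: "('a, 'c) gorder_scheme \<Rightarrow> bool" where
  "perfectly_normal L \<longleftrightarrow> Coz L = carrier L"

text \<open>Replacing the carrier keeps the order of \<open>L\<close>, but the joins and meets demanded by
  \<^locale>\<open>frame\<close> are then the ones taken among cozero elements.\<close>

definition cozero_frame :: "('a, 'c) gorder_scheme \<Rightarrow> bool" where
  "cozero_frame L \<longleftrightarrow> frame (L\<lparr>carrier := Coz L\<rparr>)"

lemma partial_order_open_sets: "partial_order open_sets_frame"
  by unfold_locales (auto simp: open_sets_frame_def)

lemma least_Upper_open_sets:
  assumes "A \<subseteq> carrier open_sets_frame"
  shows "least open_sets_frame (\<Union>A) (Upper open_sets_frame A)"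
  using assms by (auto simp: least_def Upper_def open_sets_frame_def)

lemma greatest_Lower_open_sets:
  assumes "A \<subseteq> carrier open_sets_frame"
  shows "greatest open_sets_frame (\<Union>{U. open U \<and> U \<subseteq> \<Inter>A}) (Lower open_sets_frame A)"
  using assms unfolding greatest_def Lower_def open_sets_frame_def by auto

lemma sup_open_sets:
  assumes "A \<subseteq> carrier open_sets_frame"
  shows "\<Squnion>\<^bsub>open_sets_frame\<^esub> A = \<Union>A"
proof -
  interpret partial_order open_sets_frame by (rule partial_order_open_sets)
  show ?thesis unfolding sup_def
    using least_Upper_open_sets[OF assms] least_unique by (metis someI_ex)
qed

lemma meet_open_sets:
  assumes "U \<in> carrier open_sets_frame" "V \<in> carrier open_sets_frame"
  shows "U \<sqinter>\<^bsub>open_sets_frame\<^esub> V = U \<inter> V"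
proof -
  interpret partial_order open_sets_frame by (rule partial_order_open_sets)
  have "greatest open_sets_frame (U \<inter> V) (Lower open_sets_frame {U, V})"
    using assms by (auto simp: greatest_def Lower_def open_sets_frame_def)
  then show ?thesis unfolding meet_def inf_def
    using greatest_unique by (metis someI_ex)
qed

lemma frame_open_sets: "frame (open_sets_frame :: 'a::topological_space set gorder)"
proof -
  let ?O = "open_sets_frame :: 'a set gorder"
  interpret partial_order ?O by (rule partial_order_open_sets)
  interpret Complete_Lattice.complete_lattice ?O
    by unfold_locales (use least_Upper_open_sets greatest_Lower_open_sets in blast)+
  show ?thesis
  proof
    fix U :: "'a set" and A
    assume U: "U \<in> carrier ?O" and A: "A \<subseteq> carrier ?O"
    have "\<Union>A \<in> carrier ?O"
      using A by (auto simp: open_sets_frame_def)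
    moreover have eq: "(\<lambda>V. U \<sqinter>\<^bsub>?O\<^esub> V) ` A = (\<inter>) U ` A"
      using U A by (auto simp: meet_open_sets subset_iff)
    moreover have "(\<inter>) U ` A \<subseteq> carrier ?O"
      using U A by (auto simp: open_sets_frame_def)
    ultimately show "U \<sqinter>\<^bsub>?O\<^esub> \<Squnion>\<^bsub>?O\<^esub> A
        = \<Squnion>\<^bsub>?O\<^esub> ((\<lambda>V. U \<sqinter>\<^bsub>?O\<^esub> V) ` A)"
      using U A by (auto simp: sup_open_sets meet_open_sets)
  qed
qed

end

(* If a is a join of cozero elements S and a meet of cozero elements T, then the join c of S taken
   inside Coz L lies below every member of T, since these are cozero upper bounds of S.  Hence
   a \<le> c \<le> a, so a is cozero. *)
theory Submission
  imports Defs
begin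

text \<open>The complement of \<open>{0}\<close> is open in the reals, so every \<open>h\<close> in
  the definition of \<open>Coz\<close> sends it into \<open>carrier L\<close>.\<close>

lemma Coz_subset_carrier: "Coz L \<subseteq> carrier L"
  by (auto simp: Coz_def frame_hom_def open_sets_frame_def Pi_iff Diff_eq open_Int open_Compl)

context Complete_Lattice.complete_lattice
begin

text \<open>The squeezing argument for an arbitrary subset \<open>C\<close> that is complete in the
  induced order; it is applied with \<open>C = Coz L\<close>. Joins and meets in the conditions on
  \<open>a\<close> are those of \<open>L\<close>.\<close>

lemma join_meet_mem_complete_subset:
  assumes C: "C \<subseteq> carrier L" "Complete_Lattice.complete_lattice (L\<lparr>carrier := C\<rparr>)"
    and S: "S \<subseteq> C" "a = \<Squnion>S" and T: "T \<subseteq> C" "a = \<Sqinter>T"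
  shows "a \<in> C"
proof -
  interpret C: Complete_Lattice.complete_lattice "L\<lparr>carrier := C\<rparr>" by (fact C(2))
  have SL: "S \<subseteq> carrier L" and TL: "T \<subseteq> carrier L"
    using C S T by auto
  have a: "a \<in> carrier L"
    using S(2) SL by simp
  \<comment> \<open>\<open>c\<close> is the join of \<open>S\<close> inside \<open>C\<close>. Fewer
    upper bounds compete there than in \<open>L\<close>, so a priori \<open>c\<close> may lie
    strictly above \<open>a\<close>.\<close>
  obtain c where "least (L\<lparr>carrier := C\<rparr>) c (Upper (L\<lparr>carrier := C\<rparr>) S)"
    using C.sup_exists[of S] S(1) by auto
  then have cC: "c \<in> C" and c_upper: "\<And>s. s \<in> S \<Longrightarrow> s \<sqsubseteq> c"
    and c_least: "\<And>u. u \<in> C \<Longrightarrow> (\<And>s. s \<in> S \<Longrightarrow> s \<sqsubseteq> u) \<Longrightarrow> c \<sqsubseteq> u"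
    using S(1) by (auto simp: least_def Upper_def)
  have c: "c \<in> carrier L"
    using cC C(1) by auto
  have "a \<sqsubseteq> c"
    unfolding S(2) using c_upper SL c by (intro sup_least) auto
  \<comment> \<open>Since \<open>T\<close> lies in \<open>C\<close>, leastness of \<open>c\<close>
    may be tested against each \<open>t\<close> in \<open>T\<close>; it bounds \<open>S\<close>
    because \<open>s \<sqsubseteq> a \<sqsubseteq> t\<close>.\<close>
  moreover have "c \<sqsubseteq> a"
    unfolding T(2)
  proof (intro inf_greatest TL c c_least)
    fix t s assume t: "t \<in> T" and s: "s \<in> S"
    have "s \<sqsubseteq> a" unfolding S(2) using SL s by (rule sup_upper)
    moreover have "a \<sqsubseteq> t" unfolding T(2) using TL t by (rule inf_lower)
    ultimately show "s \<sqsubseteq> t"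
      using SL TL s t a by (meson le_trans subsetD)
  qed (use T(1) in auto)
  ultimately show ?thesis
    using a c cC by (metis le_antisym)
qed

lemma inf_singleton: "a \<in> carrier L \<Longrightarrow> \<Sqinter>{a} = a"
  by (intro le_antisym inf_lower inf_greatest) auto

end

theorem theorem3p18:
  fixes L :: "('a, 'b) gorder_scheme"
  assumes "frame L" and "completely_regular L"
  shows "perfectly_normal L \<longleftrightarrow> cozero_frame L \<and> perfectly_regular L"
proof -
  interpret frame L by (fact assms(1))
  show ?thesis
  proof
    assume "perfectly_normal L"
    then have Coz: "Coz L = carrier L"
      by (simp add: perfectly_normal_def)
    \<comment> \<open>Replacing the carrier by \<open>Coz L\<close> now gives back \<open>L\<close>
      itself.\<close>
    have "cozero_frame L"
      using assms(1) by (simp add: cozero_frame_def Coz)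
    \<comment> \<open>Each element is cozero, hence the meet of its own singleton; the join half of
      perfect regularity is complete regularity.\<close>
    moreover have "\<exists>S\<subseteq>Coz L. a = \<Sqinter>\<^bsub>L\<^esub> S" if "a \<in> carrier L" for a
      using that by (intro exI[of _ "{a}"]) (simp add: Coz inf_singleton)
    ultimately show "cozero_frame L \<and> perfectly_regular L"
      using assms(2) by (simp add: perfectly_regular_def completely_regular_def)
  next
    assume *: "cozero_frame L \<and> perfectly_regular L"
    then have complete: "Complete_Lattice.complete_lattice (L\<lparr>carrier := Coz L\<rparr>)"
      by (simp add: cozero_frame_def frame_def)
    have "a \<in> Coz L" if "a \<in> carrier L" for a
      using * that join_meet_mem_complete_subset[OF Coz_subset_carrier complete]
      unfolding perfectly_regular_def by metis
    then show "perfectly_normal L"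
      using Coz_subset_carrier[of L] by (auto simp: perfectly_normal_def)
  qed
qed

end
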